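(* Let $\mathcal{G}=(\mathcal{V},\mathcal{E})$ be a bipartite graph with weights $\mathcal{W}$ and (unique) optimal assignment $\Pi^*\in LAP(\mathcal{G},\mathcal{W})$, and let $N$ be the maximal number of assigned edges in an assignment over $\mathcal{G}$. Consider the sequence of perturbations $\Delta^k=\{\delta^k_{ij}\mid (i,j)\in\mathcal{E}\}$, $k\ge 0$, generated by $$\delta^0_{ij}=0,\qquad \delta^{k+1}_{ij}=\delta^k_{ij}+\frac{1}{2N}\,s_{ij}(\mathcal{W}+\Delta^k)\qquad\text{for all }(i,j)\in\mathcal{E},\ k\ge 0,$$ where $s_{ij}(\mathcal{W}+\Delta^k)$ is the element-wise sensitivity of edge $(i,j)$ for the weights $\mathcal{W}+\Delta^k$ with respect to $\Pi^*$. Then the sequence $\Delta^k$ converges as $k\to\infty$, and its limit $\Delta$ is a critical perturbation.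
   Context: $\mathcal{G}=(\mathcal{V},\mathcal{E})$ is a finite bipartite graph with $\mathcal{V}=\mathcal{V}_A\cup\mathcal{V}_T$, $\mathcal{V}_A\cap\mathcal{V}_T=\emptyset$, $\mathcal{E}\subseteq\mathcal{V}_A\times\mathcal{V}_T$ and $|\mathcal{V}_A|\ge|\mathcal{V}_T|\ge 1$ ($\mathcal{V}_A$ = agents, $\mathcal{V}_T$ = tasks). Edge weights are real numbers $\mathcal{W}=\{w_{ij}\in\mathbb{R}\mid (i,j)\in\mathcal{E}\}$. An assignment is a family $\Pi=\{\pi_{ij}\in\{0,1\}\mid (i,j)\in\mathcal{E}\}$ satisfying $\sum_{i:(i,j)\in\mathcal{E}}\pi_{ij}=1$ for every $j\in\mathcal{V}_T$ and $\sum_{j:(i,j)\in\mathcal{E}}\pi_{ij}\le 1$ for every $i\in\mathcal{V}_A$. Edge $(i,j)$ is assigned in $\Pi$ if $\pi_{ij}=1$. For weights $\mathcal{U}=\{u_{ij}\}$ the cost is $f(\mathcal{U},\Pi)=\sum_{(i,j)\in\mathcal{E}}\pi_{ij}u_{ij}$. $LAP(\mathcal{G},\mathcal{U})$ denotes the set of assignments minimizing $f(\mathcal{U},\cdot)$ over all assignments. Standing assumption: the optimal assignment for the initial weights is unique, i.e. $LAP(\mathcal{G},\mathcal{W})=\{\Pi^*\}$, $\Pi^*=\{\pi^*_{ij}\}$. A perturbation is a family of real numbers $\Delta=\{\delta_{ij}\mid (i,j)\in\mathcal{E}\}$, and $\mathcal{W}+\Delta:=\{w_{ij}+\delta_{ij}\mid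 (i,j)\in\mathcal{E}\}$. A perturbation $\Delta$ is called allowable if $\Pi^*\in LAP(\mathcal{G},\mathcal{W}+\Delta)$ (the optimizer for the perturbed weights need not be unique). Convergence of perturbations means convergence of each entry in $\mathbb{R}$. Element-wise sensitivities: for weights $\mathcal{U}$ and $(a,b)\in\mathcal{E}$ let $\Pi_{ab}$ be a minimizer of $f(\mathcal{U},\Pi)$ over all assignments $\Pi$ with $\pi_{ab}\ne\pi^*_{ab}$. It is assumed that for every $(a,b)\in\mathcal{E}$ at least one such assignment exists, so that the sensitivities are well defined. Then $$s_{ab}(\mathcal{U})=\begin{cases} f(\mathcal{U},\Pi^* )-f(\mathcal{U},\Pi_{ab}) & \text{if }\pi^*_{ab}=0,\\ f(\mathcal{U},\Pi_{ab})-f(\mathcal{U},\Pi^* ) & \text{if }\pi^*_{ab}=1.\end{cases}$$ Critical perturbation: an allowable perturbation $\Delta=\{\delta_{ij}\}$ is critical if for every family of reals $\epsilon_{ij}\ge 0$, $(i,j)\in\mathcal{E}$, with $\epsilon_{ij}>0$ for at least one edge, the perturbation $\Delta'=\{\delta'_{ij}\}$ given by $\delta'_{ij}=\delta_{ij}+\epsilon_{ij}$ if $\pi^*_{ij}=1$ and $\delta'_{ij}=\delta_{ij}-\epsilon_{ij}$ if $\pi^*_{ij}=0$ is not allowable. *)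

theory Defs
  imports "HOL-Analysis.Analysis"
begin

text \<open>Agents \<open>A\<close> and tasks \<open>T\<close> are vertices of one type; an edge is a pair (agent, task).
  Families indexed by the edge set \<open>E\<close> are functions on all pairs. Weights and perturbations are
  only ever inspected on \<open>E\<close>, whereas assignments are extensional (\<open>undefined\<close> outside \<open>E\<close>), so that
  equality of assignments is equality on \<open>E\<close>.\<close>

definition agent_task_graph :: "'v set \<Rightarrow> 'v set \<Rightarrow> ('v \<times> 'v) set \<Rightarrow> bool" where
  "agent_task_graph A T E \<longleftrightarrow>
     finite A \<and> finite T \<and> A \<inter> T = {} \<and> E \<subseteq> A \<times> T \<and> card A \<ge> card T \<and> card T \<ge> 1"

definition assignments :: "'v set \<Rightarrow> 'v set \<Rightarrow> ('v \<times> 'v) set \<Rightarrow> ('v \<times> 'v \<Rightarrow> real) set" where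
  "assignments A T E =
     {\<pi> \<in> E \<rightarrow>\<^sub>E {0, 1}.
        (\<forall>j\<in>T. (\<Sum>i | (i, j) \<in> E. \<pi> (i, j)) = 1) \<and>
        (\<forall>i\<in>A. (\<Sum>j | (i, j) \<in> E. \<pi> (i, j)) \<le> 1)}"

definition cost :: "('v \<times> 'v) set \<Rightarrow> ('v \<times> 'v \<Rightarrow> real) \<Rightarrow> ('v \<times> 'v \<Rightarrow> real) \<Rightarrow> real" where
  "cost E U \<pi> = (\<Sum>e\<in>E. \<pi> e * U e)"

definition LAP ::
  "'v set \<Rightarrow> 'v set \<Rightarrow> ('v \<times> 'v) set \<Rightarrow> ('v \<times> 'v \<Rightarrow> real) \<Rightarrow> ('v \<times> 'v \<Rightarrow> real) set" where
  "LAP A T E U =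
     {\<pi> \<in> assignments A T E. \<forall>\<pi>'\<in>assignments A T E. cost E U \<pi> \<le> cost E U \<pi>'}"

definition max_assigned :: "'v set \<Rightarrow> 'v set \<Rightarrow> ('v \<times> 'v) set \<Rightarrow> nat" where
  "max_assigned A T E = Max ((\<lambda>\<pi>. card {e \<in> E. \<pi> e = 1}) ` assignments A T E)"

text \<open>In the remaining definitions \<open>\<pi>opt\<close> is the reference assignment, optimal for the weights
  \<open>W\<close> before perturbation.\<close>

definition allowable ::
  "'v set \<Rightarrow> 'v set \<Rightarrow> ('v \<times> 'v) set \<Rightarrow> ('v \<times> 'v \<Rightarrow> real) \<Rightarrow> ('v \<times> 'v \<Rightarrow> real)
     \<Rightarrow> ('v \<times> 'v \<Rightarrow> real) \<Rightarrow> bool" where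
  "allowable A T E W \<pi>opt \<Delta> \<longleftrightarrow> \<pi>opt \<in> LAP A T E (\<lambda>e. W e + \<Delta> e)"

definition critical ::
  "'v set \<Rightarrow> 'v set \<Rightarrow> ('v \<times> 'v) set \<Rightarrow> ('v \<times> 'v \<Rightarrow> real) \<Rightarrow> ('v \<times> 'v \<Rightarrow> real)
     \<Rightarrow> ('v \<times> 'v \<Rightarrow> real) \<Rightarrow> bool" where
  "critical A T E W \<pi>opt \<Delta> \<longleftrightarrow>
     allowable A T E W \<pi>opt \<Delta> \<and>
     (\<forall>\<epsilon>. (\<forall>e\<in>E. \<epsilon> e \<ge> 0) \<and> (\<exists>e\<in>E. \<epsilon> e > 0) \<longrightarrow>
        \<not> allowable A T E W \<pi>opt (\<lambda>e. if \<pi>opt e = 1 then \<Delta> e + \<epsilon> e else \<Delta> e - \<epsilon> e))"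

text \<open>The value does not depend on which minimizer \<open>arg_min_on\<close> selects. It is meaningful only if
  some assignment differs from \<open>\<pi>opt\<close> on the edge \<open>e\<close>.\<close>

definition sensitivity ::
  "'v set \<Rightarrow> 'v set \<Rightarrow> ('v \<times> 'v) set \<Rightarrow> ('v \<times> 'v \<Rightarrow> real) \<Rightarrow> ('v \<times> 'v \<Rightarrow> real)
     \<Rightarrow> 'v \<times> 'v \<Rightarrow> real" where
  "sensitivity A T E \<pi>opt U e =
     (let \<pi>e = arg_min_on (cost E U) {\<pi> \<in> assignments A T E. \<pi> e \<noteq> \<pi>opt e}
      in if \<pi>opt e = 0 then cost E U \<pi>opt - cost E U \<pi>e
         else cost E U \<pi>e - cost E U \<pi>opt)"

end

theory Submission
  imports Defs
begin

text \<open>Orient every edge so that increasing its weight on \<open>\<pi>opt\<close>, or decreasing it off \<open>\<pi>opt\<close>, counts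
  as positive. In this orientation, each step of the iteration adds \<open>g e / (2 * N)\<close> to the perturbation
  of \<open>e\<close>, where \<open>g e\<close> is the least optimality gap among the assignments differing from \<open>\<pi>opt\<close> on \<open>e\<close>.
  The gap of an assignment \<open>\<pi>\<close> thus drops by a sum of at most \<open>2 * N\<close> terms, each at most \<open>1 / (2 * N)\<close> of
  the gap itself, so gaps decrease but stay nonnegative. Hence the perturbations are monotone and
  bounded, their increments tend to \<open>0\<close>, and in the limit every edge lies in the difference set of an
  assignment with gap \<open>0\<close>. Any further shift on that edge makes this gap negative.\<close>

definition orient :: "('e \<Rightarrow> real) \<Rightarrow> 'e \<Rightarrow> real" where
  "orient \<pi>opt e = (if \<pi>opt e = 1 then 1 else - 1)"

definition diff_edges :: "'e set \<Rightarrow> ('e \<Rightarrow> real) \<Rightarrow> ('e \<Rightarrow> real) \<Rightarrow> 'e set" where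
  "diff_edges E \<pi>opt \<pi> = {e \<in> E. \<pi> e \<noteq> \<pi>opt e}"

definition gap ::
  "('v \<times> 'v) set \<Rightarrow> ('v \<times> 'v \<Rightarrow> real) \<Rightarrow> ('v \<times> 'v \<Rightarrow> real) \<Rightarrow> ('v \<times> 'v \<Rightarrow> real) \<Rightarrow> real" where
  "gap E \<pi>opt U \<pi> = cost E U \<pi> - cost E U \<pi>opt"

lemma orient_mult_self [simp]: "orient \<pi>opt e * (orient \<pi>opt e * x) = x"
  by (simp add: orient_def)

lemma agent_task_graph_finite_edges:
  "agent_task_graph A T E \<Longrightarrow> finite E"
  unfolding agent_task_graph_def by (meson finite_SigmaI finite_subset)

lemma finite_assignments:
  assumes "finite E"
  shows "finite (assignments A T E)"
proof (rule finite_subset)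
  show "assignments A T E \<subseteq> E \<rightarrow>\<^sub>E {0, 1}" by (auto simp: assignments_def)
  show "finite (E \<rightarrow>\<^sub>E {0, 1 :: real})" using assms by (intro finite_PiE) auto
qed

lemma assignments_zero_one:
  "\<pi> \<in> assignments A T E \<Longrightarrow> e \<in> E \<Longrightarrow> \<pi> e = 0 \<or> \<pi> e = 1"
  unfolding assignments_def using PiE_mem by fastforce

lemma allowable_iff_gap_nonneg:
  assumes "\<pi>opt \<in> assignments A T E"
  shows "allowable A T E W \<pi>opt \<Delta> \<longleftrightarrow>
    (\<forall>\<pi>\<in>assignments A T E. 0 \<le> gap E \<pi>opt (\<lambda>e. W e + \<Delta> e) \<pi>)"
  using assms by (auto simp: allowable_def LAP_def gap_def)

lemma gap_cong:
  assumes "\<And>e. e \<in> E \<Longrightarrow> U e = U' e"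
  shows "gap E \<pi>opt U \<pi> = gap E \<pi>opt U' \<pi>"
  using assms by (simp add: gap_def cost_def)

text \<open>On an edge where the two 0/1 assignments differ, \<open>\<pi> e - \<pi>opt e\<close>
  equals \<open>- orient \<pi>opt e\<close>. The two signs multiply to -1, so such an edge
  contributes \<open>- x e\<close> whichever assignment uses it; all other edges cancel.\<close>

lemma gap_add_orient:
  assumes fin: "finite E" and opt: "\<pi>opt \<in> assignments A T E" and \<pi>: "\<pi> \<in> assignments A T E"
    and V: "\<And>e. e \<in> E \<Longrightarrow> V e = U e + orient \<pi>opt e * x e"
  shows "gap E \<pi>opt V \<pi> = gap E \<pi>opt U \<pi> - sum x (diff_edges E \<pi>opt \<pi>)"
proof -
  have "gap E \<pi>opt V \<pi> = (\<Sum>e\<in>E. (\<pi> e - \<pi>opt e) * V e)"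
    by (simp add: gap_def cost_def sum_subtractf algebra_simps)
  also have "\<dots> = (\<Sum>e\<in>E. (\<pi> e - \<pi>opt e) * U e - (if \<pi> e \<noteq> \<pi>opt e then x e else 0))"
  proof (rule sum.cong)
    fix e assume "e \<in> E"
    then show "(\<pi> e - \<pi>opt e) * V e
        = (\<pi> e - \<pi>opt e) * U e - (if \<pi> e \<noteq> \<pi>opt e then x e else 0)"
      using assignments_zero_one[OF opt, of e] assignments_zero_one[OF \<pi>, of e]
      by (auto simp: V orient_def)
  qed simp
  also have "\<dots> = gap E \<pi>opt U \<pi> - sum x (diff_edges E \<pi>opt \<pi>)"
    using fin
    by (simp add: gap_def cost_def sum_subtractf algebra_simps diff_edges_def sum.inter_filter sum.distrib)
  finally show ?thesis .
qed

text \<open>An edge on which two 0/1 assignments differ is assigned in one of them. This bound is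
  where the factor \<open>2 * N\<close> in the step size comes from.\<close>

lemma card_diff_edges_le:
  assumes fin: "finite E" and opt: "\<pi>opt \<in> assignments A T E" and \<pi>: "\<pi> \<in> assignments A T E"
  shows "card (diff_edges E \<pi>opt \<pi>) \<le> 2 * max_assigned A T E"
proof -
  let ?ones = "\<lambda>\<pi>. {e \<in> E. \<pi> e = 1}"
  have ones: "card (?ones \<rho>) \<le> max_assigned A T E" if "\<rho> \<in> assignments A T E" for \<rho>
    unfolding max_assigned_def using that finite_assignments[OF fin] by (intro Max_ge) auto
  have "diff_edges E \<pi>opt \<pi> \<subseteq> ?ones \<pi>opt \<union> ?ones \<pi>"
    using assignments_zero_one[OF opt] assignments_zero_one[OF \<pi>] by (force simp: diff_edges_def)
  then have "card (diff_edges E \<pi>opt \<pi>) \<le> card (?ones \<pi>opt \<union> ?ones \<pi>)"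
    using fin by (intro card_mono) auto
  also have "\<dots> \<le> card (?ones \<pi>opt) + card (?ones \<pi>)" by (rule card_Un_le)
  also have "\<dots> \<le> 2 * max_assigned A T E" using ones[OF opt] ones[OF \<pi>] by simp
  finally show ?thesis .
qed

text \<open>The sign flip between the two cases of \<open>sensitivity\<close> is exactly
  \<open>orient\<close>, so multiplying by it merges them into one minimum of gaps. That minimum is
  attained because there are finitely many assignments.\<close>

lemma orient_sensitivity_least_gap:
  fixes U :: "'v \<times> 'v \<Rightarrow> real"
  assumes fin: "finite E" and opt: "\<pi>opt \<in> assignments A T E" and e: "e \<in> E"
    and ex: "\<exists>\<pi>\<in>assignments A T E. \<pi> e \<noteq> \<pi>opt e"
  defines "s \<equiv> orient \<pi>opt e * sensitivity A T E \<pi>opt U e"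
  shows "\<exists>\<pi>\<in>assignments A T E. \<pi> e \<noteq> \<pi>opt e \<and> s = gap E \<pi>opt U \<pi>"
    and "\<And>\<pi>. \<pi> \<in> assignments A T E \<Longrightarrow> \<pi> e \<noteq> \<pi>opt e \<Longrightarrow> s \<le> gap E \<pi>opt U \<pi>"
proof -
  define S where "S = {\<pi> \<in> assignments A T E. \<pi> e \<noteq> \<pi>opt e}"
  define m where "m = arg_min_on (cost E U) S"
  have "finite S" "S \<noteq> {}" using finite_assignments[OF fin] ex by (auto simp: S_def)
  then have m: "m \<in> S" "\<And>\<pi>. \<pi> \<in> S \<Longrightarrow> cost E U m \<le> cost E U \<pi>"
    using arg_min_if_finite[of S "cost E U"] by (auto simp: m_def not_less)
  have s: "s = gap E \<pi>opt U m"
    using assignments_zero_one[OF opt e]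
    by (auto simp: s_def sensitivity_def Let_def gap_def orient_def m_def S_def)
  show "\<exists>\<pi>\<in>assignments A T E. \<pi> e \<noteq> \<pi>opt e \<and> s = gap E \<pi>opt U \<pi>"
    using m(1) s by (auto simp: S_def)
  show "s \<le> gap E \<pi>opt U \<pi>" if "\<pi> \<in> assignments A T E" "\<pi> e \<noteq> \<pi>opt e" for \<pi>
    using m(2)[of \<pi>] that by (simp add: s gap_def S_def)
qed

text \<open>The shift in the definition of \<open>critical\<close> is an oriented one, so it lowers
  every gap by the sum of \<open>\<epsilon>\<close> over the difference set. A tight assignment
  through an edge with positive \<open>\<epsilon>\<close> then becomes strictly cheaper than
  \<open>\<pi>opt\<close>.\<close>

lemma critical_if_tight_edges:
  assumes fin: "finite E" and opt: "\<pi>opt \<in> assignments A T E"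
    and allow: "allowable A T E W \<pi>opt \<Delta>"
    and tight: "\<And>e. e \<in> E \<Longrightarrow>
      \<exists>\<pi>\<in>assignments A T E. \<pi> e \<noteq> \<pi>opt e \<and> gap E \<pi>opt (\<lambda>e. W e + \<Delta> e) \<pi> = 0"
  shows "critical A T E W \<pi>opt \<Delta>"
  unfolding critical_def
proof (intro conjI allI impI)
  fix \<epsilon> :: "'a \<times> 'a \<Rightarrow> real"
  let ?V = "\<lambda>e. W e + (if \<pi>opt e = 1 then \<Delta> e + \<epsilon> e else \<Delta> e - \<epsilon> e)"
  assume "(\<forall>e\<in>E. 0 \<le> \<epsilon> e) \<and> (\<exists>e\<in>E. 0 < \<epsilon> e)"
  then obtain e where nonneg: "\<forall>e\<in>E. 0 \<le> \<epsilon> e" and e: "e \<in> E" "0 < \<epsilon> e" by blast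
  obtain \<pi> where \<pi>: "\<pi> \<in> assignments A T E" "\<pi> e \<noteq> \<pi>opt e"
      "gap E \<pi>opt (\<lambda>e. W e + \<Delta> e) \<pi> = 0"
    using tight[OF e(1)] by blast
  have "gap E \<pi>opt ?V \<pi> = - sum \<epsilon> (diff_edges E \<pi>opt \<pi>)"
    using gap_add_orient[OF fin opt \<pi>(1), of ?V "\<lambda>e. W e + \<Delta> e" \<epsilon>] \<pi>(3)
    by (simp add: orient_def)
  moreover have "0 < sum \<epsilon> (diff_edges E \<pi>opt \<pi>)"
    using fin nonneg e \<pi>(2) by (intro sum_pos2[of _ e]) (auto simp: diff_edges_def)
  ultimately show "\<not> allowable A T E W \<pi>opt
      (\<lambda>e. if \<pi>opt e = 1 then \<Delta> e + \<epsilon> e else \<Delta> e - \<epsilon> e)"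
    using \<pi>(1) by (auto simp: allowable_iff_gap_nonneg[OF opt] not_le intro!: bexI[of _ \<pi>])
qed (rule allow)

theorem proposition2:
  fixes A T :: "'v set" and E :: "('v \<times> 'v) set"
    and W \<pi>opt :: "'v \<times> 'v \<Rightarrow> real"
    and \<Delta> :: "nat \<Rightarrow> 'v \<times> 'v \<Rightarrow> real"
    and N :: nat
  assumes graph: "agent_task_graph A T E"
    and unique_opt: "LAP A T E W = {\<pi>opt}"
    and sens_defined: "\<forall>e\<in>E. \<exists>\<pi>\<in>assignments A T E. \<pi> e \<noteq> \<pi>opt e"
    and N_eq: "N = max_assigned A T E"
    and start: "\<forall>e\<in>E. \<Delta> 0 e = 0"
    and step: "\<forall>k. \<forall>e\<in>E. \<Delta> (Suc k) e =
                 \<Delta> k e + 1 / (2 * real N) * sensitivity A T E \<pi>opt (\<lambda>e'. W e' + \<Delta> k e') e"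
  shows "\<exists>\<Delta>lim. (\<forall>e\<in>E. (\<lambda>k. \<Delta> k e) \<longlonglongrightarrow> \<Delta>lim e) \<and> critical A T E W \<pi>opt \<Delta>lim"
proof -
  define P where "P = assignments A T E"
  define G where "G k = gap E \<pi>opt (\<lambda>e. W e + \<Delta> k e)" for k
  define g where "g k e = orient \<pi>opt e * sensitivity A T E \<pi>opt (\<lambda>e'. W e' + \<Delta> k e') e" for k e
  define x where "x k e = orient \<pi>opt e * \<Delta> k e" for k e
  have fin: "finite E" using graph by (rule agent_task_graph_finite_edges)
  have opt: "\<pi>opt \<in> assignments A T E" using unique_opt by (auto simp: LAP_def)
  have finP: "finite P" unfolding P_def using fin by (rule finite_assignments)
  have g_attained: "\<exists>\<pi>\<in>P. \<pi> e \<noteq> \<pi>opt e \<and> g k e = G k \<pi>" if "e \<in> E" for k e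
    unfolding g_def G_def P_def
    using orient_sensitivity_least_gap(1)[OF fin opt that] sens_defined that by blast
  have g_le: "g k e \<le> G k \<pi>" if "\<pi> \<in> P" "e \<in> diff_edges E \<pi>opt \<pi>" for k e \<pi>
    unfolding g_def G_def using that sens_defined
    by (intro orient_sensitivity_least_gap(2)[OF fin opt]) (auto simp: P_def diff_edges_def)
  have \<Delta>_Suc: "\<Delta> (Suc k) e = \<Delta> k e + orient \<pi>opt e * (g k e / (2 * real N))" if "e \<in> E" for k e
    using step that by (simp add: g_def orient_def)
  have x_Suc: "x (Suc k) e = x k e + g k e / (2 * real N)" if "e \<in> E" for k e
    using \<Delta>_Suc[OF that] by (simp add: x_def distrib_left del: times_divide_eq_right)
  have G_Suc: "G (Suc k) \<pi> = G k \<pi> - (\<Sum>e\<in>diff_edges E \<pi>opt \<pi>. g k e / (2 * real N))"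
    if "\<pi> \<in> P" for k \<pi>
    unfolding G_def
    by (rule gap_add_orient[OF fin opt]) (use that \<Delta>_Suc in \<open>auto simp: P_def\<close>)
  \<comment> \<open>Here the first \<open>k\<close> steps are treated as a single oriented shift of
    total size \<open>x k\<close>; this yields the upper bound on \<open>x k\<close> below.\<close>
  have G_start: "G k \<pi> = G 0 \<pi> - (\<Sum>e\<in>diff_edges E \<pi>opt \<pi>. x k e)" if "\<pi> \<in> P" for k \<pi>
    unfolding G_def
    by (rule gap_add_orient[OF fin opt]) (use that start in \<open>auto simp: P_def x_def\<close>)
  have G_nonneg: "0 \<le> G k \<pi>" if "\<pi> \<in> P" for k \<pi>
    using that
  proof (induction k arbitrary: \<pi>)
    case 0
    have "\<pi>opt \<in> LAP A T E W" using unique_opt by simp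
    then have "0 \<le> gap E \<pi>opt W \<pi>" using 0 by (auto simp: LAP_def gap_def P_def)
    also have "gap E \<pi>opt W \<pi> = G 0 \<pi>" unfolding G_def by (rule gap_cong) (simp add: start)
    finally show ?case .
  next
    case (Suc k)
    let ?D = "diff_edges E \<pi>opt \<pi>"
    have "(\<Sum>e\<in>?D. g k e / (2 * real N)) \<le> (\<Sum>e\<in>?D. G k \<pi> / (2 * real N))"
      by (intro sum_mono divide_right_mono g_le Suc.prems) auto
    also have "\<dots> = real (card ?D) / (2 * real N) * G k \<pi>" by simp
    also have "\<dots> \<le> 1 * G k \<pi>"
    proof (rule mult_right_mono)
      have "real (card ?D) \<le> 2 * real N"
        using card_diff_edges_le[OF fin opt] Suc.prems unfolding P_def N_eq
        by (metis of_nat_le_iff of_nat_mult of_nat_numeral)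
      \<comment> \<open>For \<open>N = 0\<close> the quotient is 0 by convention, so the bound holds
        in that case too.\<close>
      then show "real (card ?D) / (2 * real N) \<le> 1" by (auto simp: divide_le_eq_1)
    qed (rule Suc.IH[OF Suc.prems])
    finally show ?case using G_Suc[OF Suc.prems] by simp
  qed
  have g_nonneg: "0 \<le> g k e" if "e \<in> E" for k e
    using g_attained[OF that] G_nonneg by metis
  have x_mono: "incseq (\<lambda>k. x k e)" if "e \<in> E" for e
    using x_Suc[OF that] g_nonneg[OF that] by (intro incseq_SucI) simp
  have x_nonneg: "0 \<le> x k e" if "e \<in> E" for k e
    using incseqD[OF x_mono[OF that], of 0 k] start that by (simp add: x_def)
  have "convergent (\<lambda>k. x k e)" if "e \<in> E" for e
  proof -
    obtain \<pi> where \<pi>: "\<pi> \<in> P" "e \<in> diff_edges E \<pi>opt \<pi>"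
      using sens_defined \<open>e \<in> E\<close> by (auto simp: P_def diff_edges_def)
    \<comment> \<open>The total shift over the difference set of \<open>\<pi>\<close> cannot exceed
      its initial gap, since the gap stays nonnegative; \<open>x k e\<close> is one of the
      nonnegative summands.\<close>
    have "x k e \<le> G 0 \<pi>" for k
    proof -
      have "x k e \<le> (\<Sum>e\<in>diff_edges E \<pi>opt \<pi>. x k e)"
        using fin \<pi>(2) x_nonneg by (intro member_le_sum) (auto simp: diff_edges_def)
      also have "\<dots> \<le> G 0 \<pi>" using G_start[OF \<pi>(1), of k] G_nonneg[OF \<pi>(1), of k] by simp
      finally show ?thesis .
    qed
    then show ?thesis
      using incseq_convergent[OF x_mono[OF that], of "G 0 \<pi>"] unfolding convergent_def by blast
  qed
  then obtain xlim where xlim: "\<And>e. e \<in> E \<Longrightarrow> (\<lambda>k. x k e) \<longlonglongrightarrow> xlim e"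
    unfolding convergent_def by metis
  define \<Delta>lim where "\<Delta>lim e = orient \<pi>opt e * xlim e" for e
  have lim: "(\<lambda>k. \<Delta> k e) \<longlonglongrightarrow> \<Delta>lim e" if "e \<in> E" for e
    using tendsto_mult_left[OF xlim[OF that], of "orient \<pi>opt e"]
    by (simp add: x_def \<Delta>lim_def)
  define Glim where "Glim = gap E \<pi>opt (\<lambda>e. W e + \<Delta>lim e)"
  have G_lim: "(\<lambda>k. G k \<pi>) \<longlonglongrightarrow> Glim \<pi>" for \<pi>
    unfolding G_def Glim_def gap_def cost_def by (intro tendsto_intros lim)
  have G_mono: "decseq (\<lambda>k. G k \<pi>)" if "\<pi> \<in> P" for \<pi>
  proof (rule decseq_SucI)
    fix k
    have "0 \<le> (\<Sum>e\<in>diff_edges E \<pi>opt \<pi>. g k e / (2 * real N))"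
      using g_nonneg by (intro sum_nonneg) (auto simp: diff_edges_def)
    then show "G (Suc k) \<pi> \<le> G k \<pi>" using G_Suc[OF that] by simp
  qed
  have Glim_nonneg: "0 \<le> Glim \<pi>" if "\<pi> \<in> P" for \<pi>
    using G_nonneg[OF that] by (intro LIMSEQ_le_const[OF G_lim]) auto
  have tight: "\<exists>\<pi>\<in>P. \<pi> e \<noteq> \<pi>opt e \<and> Glim \<pi> = 0" if e: "e \<in> E" for e
  proof -
    define S where "S = {\<pi> \<in> P. \<pi> e \<noteq> \<pi>opt e}"
    have S: "finite S" "S \<noteq> {}" using finP sens_defined e by (auto simp: S_def P_def)
    then obtain \<rho> where \<rho>: "\<rho> \<in> P" "\<rho> e \<noteq> \<pi>opt e" by (auto simp: S_def)
    \<comment> \<open>Recovering \<open>g k e\<close> from an increment of \<open>x\<close> means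
      multiplying by \<open>2 * N\<close>, which requires \<open>N > 0\<close>; a nonempty
      difference set forces this.\<close>
    have "card (diff_edges E \<pi>opt \<rho>) > 0"
      using fin e \<rho>(2) unfolding card_gt_0_iff diff_edges_def
      by (intro conjI) (blast, simp)
    then have N_pos: "N > 0"
      using card_diff_edges_le[OF fin opt, of \<rho>] \<rho>(1) by (auto simp: P_def N_eq)
    have "(\<lambda>k. (x (Suc k) e - x k e) * (2 * real N)) \<longlonglongrightarrow> (xlim e - xlim e) * (2 * real N)"
      by (intro tendsto_intros LIMSEQ_Suc xlim e)
    then have g_lim: "(\<lambda>k. g k e) \<longlonglongrightarrow> 0" using N_pos by (simp add: x_Suc[OF e])
    \<comment> \<open>The assignment attaining \<open>g k e\<close> may change with
      \<open>k\<close>. Comparing with the least limit gap over the finite set \<open>S\<close>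
      avoids passing to a subsequence, because each gap decreases to its limit.\<close>
    have "Min (Glim ` S) \<le> g k e" for k
    proof -
      obtain \<pi> where \<pi>: "\<pi> \<in> S" "g k e = G k \<pi>"
        using g_attained[OF e, of k] by (auto simp: S_def)
      have "Min (Glim ` S) \<le> Glim \<pi>" using S \<pi>(1) by simp
      also have "\<dots> \<le> G k \<pi>"
        using \<pi>(1) by (intro decseq_ge[OF G_mono G_lim]) (auto simp: S_def)
      finally show ?thesis using \<pi>(2) by simp
    qed
    then have "Min (Glim ` S) \<le> 0" by (intro LIMSEQ_le_const[OF g_lim]) auto
    moreover have "Min (Glim ` S) \<in> Glim ` S" using S by (intro Min_in) auto
    ultimately obtain \<pi> where "\<pi> \<in> S" "Glim \<pi> \<le> 0" by auto
    then show ?thesis using Glim_nonneg by (force simp: S_def)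
  qed
  have "critical A T E W \<pi>opt \<Delta>lim"
  proof (rule critical_if_tight_edges[OF fin opt])
    show "allowable A T E W \<pi>opt \<Delta>lim"
      using Glim_nonneg by (simp add: allowable_iff_gap_nonneg[OF opt] Glim_def P_def)
  qed (use tight in \<open>simp add: Glim_def P_def\<close>)
  then show ?thesis using lim by blast
qed

end
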